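(* Let $G$ be a 2-connected chordless graph that is not 2-sparse. Let $(X,Y,a,b)$ be a split of a proper 2-cutset of $G$ such that $|X|$ is minimum among all splits of proper 2-cutsets of $G$. Then $a$ and $b$ each have at least two neighbours in $X$, and the block $G_X$ is 2-sparse.
   Context: Graphs are finite and simple. A graph is chordless if no cycle has a chord (an edge joining two vertices of the cycle that is not an edge of the cycle). A graph is 2-sparse if every edge is incident to at least one vertex of degree at most 2. A proper 2-cutset of a connected graph $G=(V,E)$ is a pair of non-adjacent vertices $a,b$ such that $V$ can be partitioned into non-empty sets $X$, $Y$ and $\{a,b\}$ so that there is no edge between $X$ and $Y$, both $G[X\cup\{a,b\}]$ and $G[Y\cup\{a,b\}]$ contain an $ab$-path, and neither $G[X\cup\{a,b\}]$ nor $G[Y\cup\{a,b\}]$ is a chordless path (induced path); $(X,Y,a,b)$ is then called a split of this proper 2-cutset. The block $G_X$ is the graph obtained from $G[X\cup\{a,b\}]$ by adding a new vertex $w$ adjacent exactly to $a$ and $b$. *)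

theory Defs
  imports "Graph_Theory.Graph_Theory"
begin

text \<open>
  Undirected simple graphs are symmetric loop-free digraphs (locale \<^locale>\<open>pair_graph\<close>),
  so an edge \<open>uv\<close> is the pair of arcs \<open>(u,v)\<close>, \<open>(v,u)\<close> and the out-degree of a
  vertex is its degree.
\<close>

definition walk_edges :: "('a, 'b) pre_digraph \<Rightarrow> 'b awalk \<Rightarrow> ('a \<times> 'a) set" where
  "walk_edges G p = arc_to_ends G ` set p \<union> (arc_to_ends G ` set p)\<inverse>"

text \<open>The length bound is needed because \<open>u, v, u\<close> is a cycle of a symmetric digraph.\<close>

definition ucycle :: "('a, 'b) pre_digraph \<Rightarrow> 'b awalk \<Rightarrow> bool" where
  "ucycle G p \<longleftrightarrow> pre_digraph.cycle G p \<and> 3 \<le> length p"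

definition cycle_chord :: "('a, 'b) pre_digraph \<Rightarrow> 'b awalk \<Rightarrow> 'a \<Rightarrow> 'a \<Rightarrow> bool" where
  "cycle_chord G p u v \<longleftrightarrow>
     u \<in> tail G ` set p \<and> v \<in> tail G ` set p \<and> u \<rightarrow>\<^bsub>G\<^esub> v \<and> (u, v) \<notin> walk_edges G p"

definition chordless :: "('a, 'b) pre_digraph \<Rightarrow> bool" where
  "chordless G \<longleftrightarrow> (\<forall>p. ucycle G p \<longrightarrow> \<not> (\<exists>u v. cycle_chord G p u v))"

definition two_sparse :: "('a, 'b) pre_digraph \<Rightarrow> bool" where
  "two_sparse G \<longleftrightarrow> (\<forall>u v. u \<rightarrow>\<^bsub>G\<^esub> v \<longrightarrow> out_degree G u \<le> 2 \<or> out_degree G v \<le> 2)"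

definition two_connected :: "('a, 'b) pre_digraph \<Rightarrow> bool" where
  "two_connected G \<longleftrightarrow> 3 \<le> card (verts G) \<and> Digraph_Component.connected G \<and>
     (\<forall>v \<in> verts G. Digraph_Component.connected (pre_digraph.del_vert G v))"

text \<open>The graph \<open>H\<close> itself is a chordless path: some path of \<open>H\<close> uses all its vertices and edges.\<close>

definition is_chordless_path :: "('a, 'b) pre_digraph \<Rightarrow> bool" where
  "is_chordless_path H \<longleftrightarrow> (\<exists>u p v. pre_digraph.apath H u p v \<and>
     verts H = set (pre_digraph.awalk_verts H u p) \<and> arcs_ends H = walk_edges H p)"

definition proper_2_cutset_split ::
    "('a, 'b) pre_digraph \<Rightarrow> 'a set \<Rightarrow> 'a set \<Rightarrow> 'a \<Rightarrow> 'a \<Rightarrow> bool" where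
  "proper_2_cutset_split G X Y a b \<longleftrightarrow>
     Digraph_Component.connected G \<and>
     a \<noteq> b \<and> \<not> a \<rightarrow>\<^bsub>G\<^esub> b \<and>
     verts G = X \<union> Y \<union> {a, b} \<and>
     X \<inter> Y = {} \<and> X \<inter> {a, b} = {} \<and> Y \<inter> {a, b} = {} \<and>
     X \<noteq> {} \<and> Y \<noteq> {} \<and>
     (\<forall>x \<in> X. \<forall>y \<in> Y. \<not> x \<rightarrow>\<^bsub>G\<^esub> y) \<and>
     (\<exists>p. pre_digraph.apath (G \<restriction> (X \<union> {a, b})) a p b) \<and>
     (\<exists>p. pre_digraph.apath (G \<restriction> (Y \<union> {a, b})) a p b) \<and>
     \<not> is_chordless_path (G \<restriction> (X \<union> {a, b})) \<and>
     \<not> is_chordless_path (G \<restriction> (Y \<union> {a, b}))"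

text \<open>The new vertex \<open>w\<close> is \<^const>\<open>None\<close>; each old vertex \<open>v\<close> becomes \<open>Some v\<close>.\<close>

definition block :: "('a, 'b) pre_digraph \<Rightarrow> 'a set \<Rightarrow> 'a \<Rightarrow> 'a \<Rightarrow> 'a option pair_pre_digraph" where
  "block G X a b =
     \<lparr> pverts = insert None (Some ` (X \<union> {a, b})),
       parcs = map_prod Some Some ` arcs_ends (G \<restriction> (X \<union> {a, b})) \<union>
         {(None, Some a), (Some a, None), (None, Some b), (Some b, None)} \<rparr>"

end

theory Submission
  imports Defs
begin

text \<open>
  In a 2-connected chordless graph every edge \<open>uv\<close> is a bridge of \<open>G - z\<close> for some vertex \<open>z\<close>:
  otherwise \<open>G - uv\<close> would be 2-connected, so by Whitney's theorem it would contain a cycle through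
  \<open>u\<close> and \<open>v\<close>, and \<open>uv\<close> would be a chord of it. If moreover \<open>u\<close> and \<open>v\<close> have degree at least 3 and
  \<open>S\<close> is the side of \<open>u\<close> in \<open>G - z - uv\<close>, then \<open>{u, z}\<close> is a proper 2-cutset with side \<open>S - {u}\<close>.

  Now let \<open>(X, Y, a, b)\<close> be a minimum split. If \<open>a\<close> had a single neighbour \<open>a'\<close> in \<open>X\<close>, then
  \<open>(X - {a'}, Y \<union> {a}, a', b)\<close> would be a smaller split. If the block had an edge \<open>uv\<close> with both ends of
  degree at least 3, then \<open>u\<close> and \<open>v\<close> have degree at least 3 in \<open>G\<close> too, and intersecting the two sides
  of the bridge \<open>uv\<close> of \<open>G - z\<close> with \<open>X\<close> (replacing \<open>z\<close> by \<open>a\<close> or \<open>b\<close> if \<open>z\<close> separates them in \<open>Y\<close>)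
  gives a side contained in \<open>X\<close>, hence a split smaller than \<open>X\<close>.
\<close>

section \<open>Paths and cycles as lists of distinct vertices\<close>

lemma rtranclp_imp_distinct_list:
  assumes "F\<^sup>*\<^sup>* x y"
  shows "\<exists>xs. xs \<noteq> [] \<and> hd xs = x \<and> last xs = y \<and> distinct xs \<and> successively F xs"
  using assms
proof (induction rule: converse_rtranclp_induct)
  case base
  show ?case by (rule exI[of _ "[y]"]) simp
next
  case (step x x')
  then obtain xs where xs: "xs \<noteq> []" "hd xs = x'" "last xs = y" "distinct xs" "successively F xs"
    by blast
  show ?case
  proof (cases "x \<in> set xs")
    case True
    \<comment> \<open>The path already visits \<open>x\<close>, so its initial piece
      \<open>ys\<close> is dropped.\<close>
    then obtain ys zs where "xs = ys @ x # zs" by (meson split_list)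
    with xs show ?thesis
      by (intro exI[of _ "x # zs"]) (auto simp: successively_append_iff)
  next
    case False
    with xs step.hyps(1) show ?thesis
      by (intro exI[of _ "x # xs"]) (auto simp: successively_Cons)
  qed
qed

text \<open>The list is not closed up: the edge from \<open>last xs\<close> back to
  \<open>hd xs\<close> is a separate conjunct. The length bound prevents a single edge, run back and
  forth, from counting as a cycle.\<close>

definition list_cycle :: "('a \<Rightarrow> 'a \<Rightarrow> bool) \<Rightarrow> 'a list \<Rightarrow> bool" where
  "list_cycle E xs \<longleftrightarrow> 3 \<le> length xs \<and> distinct xs \<and> successively E xs \<and> E (last xs) (hd xs)"

lemma list_cycle_rotate:
  assumes "list_cycle E (xs @ ys)"
  shows "list_cycle E (ys @ xs)"
  using assms by (cases "xs = []"; cases "ys = []")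
    (auto simp: list_cycle_def successively_append_iff)

lemma list_cycle_reverse:
  assumes "list_cycle E xs" and "symp E"
  shows "list_cycle E (rev xs)"
proof -
  have "successively (\<lambda>x y. E y x) xs"
    using assms by (auto simp: list_cycle_def elim!: successively_mono dest: sympD)
  with assms show ?thesis
    by (auto simp: list_cycle_def hd_rev last_rev dest: sympD)
qed

lemma in_vwalk_arcsD: "(x, y) \<in> set (vwalk_arcs xs) \<Longrightarrow> x \<in> set xs \<and> y \<in> set xs"
  by (induction xs rule: vwalk_arcs.induct) auto

lemma set_vwalk_arcs_rev: "set (vwalk_arcs (rev xs)) = (set (vwalk_arcs xs))\<inverse>"
proof (induction xs)
  case (Cons x xs)
  then show ?case by (cases "xs = []") (auto simp: set_vwalk_arcs_snoc last_rev)
qed simp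

text \<open>As \<open>x\<close> occurs only once, the only arcs at \<open>x\<close> join it to the
  entries next to it. The degree bounds on induced paths rest on this.\<close>

lemma vwalk_arcs_neighbour:
  assumes "distinct (ys @ x # zs)"
    and "(x, y) \<in> set (vwalk_arcs (ys @ x # zs)) \<or> (y, x) \<in> set (vwalk_arcs (ys @ x # zs))"
  shows "ys \<noteq> [] \<and> y = last ys \<or> zs \<noteq> [] \<and> y = hd zs"
  using assms by (cases "ys = []"; cases "zs = []")
    (auto simp: vwalk_arcs_append dest!: in_vwalk_arcsD)

lemma ex_avoiding_two:
  assumes "3 \<le> card N"
  shows "\<exists>n\<in>N. n \<noteq> p \<and> n \<noteq> q"
proof (rule ccontr)
  assume "\<not> ?thesis"
  then have "N \<subseteq> {p, q}" by auto
  then have "card N \<le> card {p, q}" by (intro card_mono) auto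
  also have "card {p, q} \<le> 2" by (simp add: card_insert_if)
  finally show False using assms by simp
qed

section \<open>2-connected graphs and Whitney's theorem on cycles\<close>

text \<open>
  Assumption \<open>cut\<close> is 2-connectivity: no vertex \<open>c\<close> separates \<open>A\<close> from the remaining vertices.
\<close>

locale biconnected =
  fixes V :: "'a set" and E :: "'a \<Rightarrow> 'a \<Rightarrow> bool"
  assumes adj_in: "E x y \<Longrightarrow> x \<in> V \<and> y \<in> V"
    and adj_sym: "E x y \<Longrightarrow> E y x"
    and adj_irrefl: "\<not> E x x"
    and card_V: "3 \<le> card V"
    and cut: "\<lbrakk>A \<subseteq> V; A \<noteq> {}; c \<in> V; c \<notin> A; \<not> V \<subseteq> insert c A\<rbrakk> \<Longrightarrow> \<exists>x\<in>A. \<exists>y\<in>V - insert c A. E x y"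
begin

lemma ex_third: "\<exists>t\<in>V. t \<noteq> p \<and> t \<noteq> q"
  using ex_avoiding_two[OF card_V] .

lemma ex_crossing_edge:
  assumes "A \<subseteq> V" "A \<noteq> {}" "A \<noteq> V"
  shows "\<exists>x\<in>A. \<exists>y\<in>V - A. E x y"
proof -
  obtain c where c: "c \<in> V" "c \<notin> A" using assms by auto
  show ?thesis
  proof (cases "V \<subseteq> insert c A")
    case False
    from cut[OF assms(1,2) c this] show ?thesis by auto
  next
    case True
    obtain a where a: "a \<in> A" using assms by auto
    obtain t where t: "t \<in> V" "t \<noteq> a" "t \<noteq> c" using ex_third by blast
    \<comment> \<open>The set \<open>A\<close> misses only \<open>c\<close>, so \<open>cut\<close>
      cannot be used with \<open>c\<close> as the deleted vertex; a vertex \<open>a\<close> of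
      \<open>A\<close> is deleted instead.\<close>
    have "\<exists>x\<in>A - {a}. \<exists>y\<in>V - insert a (A - {a}). E x y"
      using assms a c t True by (intro cut) auto
    then show ?thesis using a by auto
  qed
qed

text \<open>If the set \<open>R\<close> of vertices reached from \<open>w\<close> missed
  \<open>K\<close>, then \<open>c\<close> would separate \<open>R\<close> from \<open>k\<close>. The
  path serves to reroute a cycle.\<close>

lemma path_to_set:
  assumes "w \<in> V" "c \<in> V" "w \<noteq> c" "K \<subseteq> V" "k \<in> K" "k \<noteq> c"
  obtains ws x where "distinct (ws @ [x])" "hd (ws @ [x]) = w" "x \<in> K" "set ws \<inter> K = {}"
    "c \<notin> set (ws @ [x])" "successively E (ws @ [x])"
proof -
  \<comment> \<open>A step along \<open>F\<close> never enters \<open>c\<close> and never leaves a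
    vertex of \<open>K\<close>, so such a path ends as soon as it meets \<open>K\<close>.\<close>
  define F where "F x y \<longleftrightarrow> E x y \<and> y \<noteq> c \<and> x \<notin> K" for x y
  define R where "R = {x. F\<^sup>*\<^sup>* w x}"
  have R: "x \<in> V \<and> x \<noteq> c" if "F\<^sup>*\<^sup>* w x" for x
    using that by (induction) (use assms in \<open>auto simp: F_def dest: adj_in\<close>)
  have "R \<inter> K \<noteq> {}"
  proof
    assume "R \<inter> K = {}"
    have "\<exists>x\<in>R. \<exists>y\<in>V - insert c R. E x y"
      using R \<open>R \<inter> K = {}\<close> assms by (intro cut) (auto simp: R_def)
    then obtain x y where "x \<in> R" "y \<in> V" "y \<noteq> c" "y \<notin> R" "E x y" by auto
    moreover have "F x y" using calculation \<open>R \<inter> K = {}\<close> by (auto simp: F_def)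
    ultimately show False unfolding R_def by (auto intro: rtranclp.rtrancl_into_rtrancl)
  qed
  then obtain x where x: "x \<in> K" "F\<^sup>*\<^sup>* w x" by (auto simp: R_def)
  from rtranclp_imp_distinct_list[OF this(2)] obtain xs where
    xs: "xs \<noteq> []" "hd xs = w" "last xs = x" "distinct xs" "successively F xs" by blast
  define ws where "ws = butlast xs"
  have ws: "xs = ws @ [x]" using xs by (auto simp: ws_def)
  \<comment> \<open>Only the tail is known to avoid \<open>c\<close>, because \<open>F\<close>
    restricts the target of a step; the start \<open>w\<close> differs from \<open>c\<close> by
    assumption.\<close>
  have *: "set ys \<inter> K = {} \<and> c \<notin> set (tl (ys @ [x]))" if "successively F (ys @ [x])" for ys
    using that
  proof (induction ys)
    case (Cons y ys)
    then show ?case by (cases ys) (auto simp: F_def successively_Cons)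
  qed simp
  from *[of ws] xs ws have "set ws \<inter> K = {}" "c \<notin> set (tl xs)" by auto
  moreover have "c \<notin> set xs" using \<open>c \<notin> set (tl xs)\<close> xs(1,2) assms(3) by (cases xs) auto
  moreover have "successively E xs" using xs(5) by (rule successively_mono) (simp add: F_def)
  ultimately show ?thesis using that[of ws x] xs x ws by auto
qed

text \<open>The vertex \<open>u\<close> has a second neighbour \<open>t\<close>, and a path from
  \<open>w\<close> to \<open>t\<close> avoiding \<open>u\<close> closes up through
  \<open>u\<close>.\<close>

lemma cycle_through_edge:
  assumes "E u w"
  obtains xs where "list_cycle E xs" "u \<in> set xs" "w \<in> set xs"
proof -
  have uw: "u \<in> V" "w \<in> V" "u \<noteq> w" using assms adj_in adj_irrefl by auto
  obtain t0 where "t0 \<in> V" "t0 \<noteq> u" "t0 \<noteq> w" using ex_third by blast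
  then have "\<exists>x\<in>{u}. \<exists>y\<in>V - insert w {u}. E x y" using uw by (intro cut) auto
  then obtain t where t: "E u t" "t \<in> V" "t \<noteq> w" "t \<noteq> u" by auto
  obtain ws x where ws: "distinct (ws @ [x])" "hd (ws @ [x]) = w" "x \<in> {t}"
    "u \<notin> set (ws @ [x])" "successively E (ws @ [x])"
    using path_to_set[of w u "{t}" t] uw t
    by (metis empty_subsetI insert_subset singletonI)
  have "ws \<noteq> []" using ws t by auto
  then have "list_cycle E (u # ws @ [x])"
    using ws t assms adj_sym
    by (cases ws) (auto simp: list_cycle_def successively_Cons)
  then show ?thesis using that[of "u # ws @ [x]"] \<open>ws \<noteq> []\<close> ws by (cases ws) auto
qed

text \<open>Let \<open>W\<close> consist of \<open>u\<close> and the vertices that share a cycle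
  with \<open>u\<close>. If an edge from \<open>w'\<close> to \<open>w\<close> left
  \<open>W\<close>, a cycle through \<open>u\<close> and \<open>w'\<close> could be rerouted through
  \<open>w\<close>: a path from \<open>w\<close> that avoids \<open>w'\<close> hits the cycle in
  some \<open>x\<close>, and it replaces the part of the cycle between \<open>x\<close> and
  \<open>w'\<close> that may be given up without losing \<open>u\<close>.\<close>

lemma cycle_through_two_vertices:
  assumes "u \<in> V" "v \<in> V" "u \<noteq> v"
  obtains xs where "list_cycle E xs" "u \<in> set xs" "v \<in> set xs"
proof -
  define W where "W = insert u {w \<in> V. \<exists>xs. list_cycle E xs \<and> u \<in> set xs \<and> w \<in> set xs}"
  have "W = V"
  proof (rule ccontr)
    assume "W \<noteq> V"
    moreover have "W \<subseteq> V" using assms by (auto simp: W_def)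
    ultimately obtain w' w where w: "w' \<in> W" "w \<in> V" "w \<notin> W" "E w' w"
      using ex_crossing_edge[of W] unfolding W_def by blast
    show False
    proof (cases "w' = u")
      case True
      with cycle_through_edge[of u w] w show False by (auto simp: W_def)
    next
      case False
      with w obtain zs where zs: "list_cycle E zs" "u \<in> set zs" "w' \<in> set zs"
        by (auto simp: W_def)
      have zV: "set zs \<subseteq> V"
      proof
        fix z assume z: "z \<in> set zs"
        then obtain ps qs where "zs = ps @ z # qs" by (meson split_list)
        with zs(1) have "list_cycle E (z # qs @ ps)" using list_cycle_rotate[of E ps "z # qs"] by simp
        then show "z \<in> V" by (auto simp: list_cycle_def dest: adj_in)
      qed
      have wz: "w \<notin> set zs" using w zs by (auto simp: W_def)
      have "w \<noteq> w'" "w' \<in> V" "u \<noteq> w'" using w adj_in adj_irrefl False by auto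
      then obtain ws x where ws: "distinct (ws @ [x])" "hd (ws @ [x]) = w" "x \<in> set zs"
        "set ws \<inter> set zs = {}" "w' \<notin> set (ws @ [x])" "successively E (ws @ [x])"
        using path_to_set[of w w' "set zs" u] w zs zV by metis
      have "ws \<noteq> []" using ws wz by auto
      then obtain ws' where ws': "ws = w # ws'" using ws by (cases ws) auto
      have "symp E" using adj_sym by (auto intro: sympI)
      from zs obtain ps qs where "zs = ps @ w' # qs" by (meson split_list)
      with zs(1) have cyc: "list_cycle E (w' # qs @ ps)"
        using list_cycle_rotate[of E ps "w' # qs"] by simp
      obtain rs where rs: "list_cycle E (w' # rs)" "set (w' # rs) = set zs"
        using cyc \<open>zs = _\<close> by (intro that[of "qs @ ps"]) auto
      have "x \<in> set rs" using rs ws by auto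
      then obtain as bs where ab: "rs = as @ x # bs" by (meson split_list)
      \<comment> \<open>One of the two arcs of the cycle from \<open>w'\<close> to \<open>x\<close>
        contains \<open>u\<close>. If it is the second one, it is obtained by running the cycle
        backwards.\<close>
      have "\<exists>as. u \<in> set (as @ [x]) \<and> distinct (w' # as @ [x]) \<and> successively E (w' # as @ [x])
         \<and> set as \<subseteq> set zs"
      proof (cases "u \<in> set (as @ [x])")
        case True
        moreover have "successively E ((w' # as @ [x]) @ bs)"
          using rs(1) ab by (simp add: list_cycle_def)
        then have "successively E (w' # as @ [x])" by (simp only: successively_append_iff)
        ultimately show ?thesis using rs ab
          by (intro exI[of _ as]) (auto simp: list_cycle_def)
      next
        case False': False
        then have "u \<in> set bs" using rs ab zs False by auto
        moreover have "list_cycle E (rev rs @ [w'])"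
          using list_cycle_reverse[OF rs(1) \<open>symp E\<close>] by simp
        then have "list_cycle E (w' # rev rs)"
          using list_cycle_rotate[of E "rev rs" "[w']"] by simp
        then have "successively E ((w' # rev bs @ [x]) @ rev as)"
          using ab by (simp add: list_cycle_def del: successively_rev)
        then have "successively E (w' # rev bs @ [x])" by (simp only: successively_append_iff)
        ultimately show ?thesis using rs ab
          by (intro exI[of _ "rev bs"]) (auto simp: list_cycle_def)
      qed
      then obtain as where as: "u \<in> set (as @ [x])" "distinct (w' # as @ [x])"
        "successively E (w' # as @ [x])" "set as \<subseteq> set zs" by blast
      have "successively (\<lambda>x y. E y x) (ws @ [x])"
        using ws(6) by (rule successively_mono) (rule adj_sym)
      then have rw: "successively E (x # rev ws)"
        using successively_rev[of E "ws @ [x]"] by simp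
      \<comment> \<open>The path from \<open>w\<close> to \<open>x\<close> is traversed backwards,
        so the list ends in \<open>w\<close> and is closed by the edge to \<open>w'\<close>.\<close>
      have "successively E ((w' # as @ [x]) @ rev ws)"
        using as(3) rw \<open>ws \<noteq> []\<close>
        by (subst successively_append_iff) (auto simp: successively_Cons)
      moreover have "distinct ((w' # as @ [x]) @ rev ws)" using as ws by auto
      ultimately have "list_cycle E ((w' # as @ [x]) @ rev ws)"
        using w adj_sym \<open>ws \<noteq> []\<close> ws' by (auto simp: list_cycle_def Suc_le_eq)
      moreover have "u \<in> set ((w' # as @ [x]) @ rev ws)" "w \<in> set ((w' # as @ [x]) @ rev ws)"
        using as ws' by auto
      ultimately show False using w unfolding W_def by blast
    qed
  qed
  then have "v \<in> W" using assms by simp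
  then show ?thesis using that assms by (auto simp: W_def)
qed

section \<open>Edges that become bridges when a vertex is deleted\<close>

text \<open>The edge \<open>uv\<close> is a bridge of \<open>G - z\<close>, and \<open>S\<close> is the side of \<open>u\<close>.\<close>

definition bridge :: "'a set \<Rightarrow> 'a \<Rightarrow> 'a \<Rightarrow> 'a \<Rightarrow> bool" where
  "bridge S u v z \<longleftrightarrow> S \<subseteq> V \<and> u \<in> S \<and> v \<in> V \<and> v \<notin> S \<and> z \<in> V \<and> z \<notin> S \<and> z \<noteq> v \<and>
     (\<forall>x y. E x y \<longrightarrow> x \<in> S \<longrightarrow> y \<in> S \<or> y = z \<or> x = u \<and> y = v)"

text \<open>Whitney's theorem is applied to the graph without the edge \<open>uv\<close>. If that
  graph violates \<open>cut\<close> for \<open>A\<close> and \<open>c\<close>, then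
  \<open>uv\<close> is the only edge from \<open>A\<close> to the vertices outside
  \<open>insert c A\<close>.\<close>

lemma cycle_or_bridge:
  assumes "E u v"
  shows "(\<exists>xs. list_cycle (\<lambda>x y. E x y \<and> {x, y} \<noteq> {u, v}) xs \<and> u \<in> set xs \<and> v \<in> set xs) \<or>
    (\<exists>S z. bridge S u v z)"
    (is "?cycle \<or> ?bridge")
proof (rule disjCI)
  assume nb: "\<not> ?bridge"
  have uv: "u \<in> V" "v \<in> V" "u \<noteq> v" using assms adj_in adj_irrefl by auto
  interpret H: biconnected V "\<lambda>x y. E x y \<and> {x, y} \<noteq> {u, v}"
  proof
    fix A c assume A: "A \<subseteq> V" "A \<noteq> {}" "c \<in> V" "c \<notin> A" "\<not> V \<subseteq> insert c A"
    show "\<exists>x\<in>A. \<exists>y\<in>V - insert c A. E x y \<and> {x, y} \<noteq> {u, v}"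
    proof (rule ccontr)
      assume neg: "\<not> ?thesis"
      obtain x y where xy: "x \<in> A" "y \<in> V - insert c A" "E x y" using cut[OF A] by auto
      with neg have "{x, y} = {u, v}" by blast
      then consider "x = u" "y = v" | "x = v" "y = u" by (auto simp: doubleton_eq_iff)
      then show False
      proof cases
        case 1
        have "x = u \<and> y = v" if "E x y" "x \<in> A" "y \<in> V - insert c A" for x y
        proof -
          have "{x, y} = {u, v}" using neg that by blast
          then show ?thesis using that 1 xy by (auto simp: doubleton_eq_iff)
        qed
        then have "bridge A u v c"
          using A(1,3,4) xy(1,2) adj_in uv(2) unfolding bridge_def 1 by blast
        then show False using nb by blast
      next
        case 2
        \<comment> \<open>Now \<open>A\<close> contains \<open>v\<close>, so the side of
          \<open>u\<close> is the complement of \<open>insert c A\<close>.\<close>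
        have "x = u \<and> y = v" if "E x y" "x \<in> V - insert c A" "y \<in> A" for x y
        proof -
          have "{y, x} = {u, v}" using neg that adj_sym[OF that(1)] by blast
          then show ?thesis using that 2 xy by (auto simp: doubleton_eq_iff)
        qed
        then have "bridge (V - insert c A) u v c"
          using A(1,3,4) xy(1,2) adj_in uv(1,2) unfolding bridge_def 2 by blast
        then show False using nb by blast
      qed
    qed
  qed (use adj_in adj_sym adj_irrefl card_V in \<open>auto simp: insert_commute\<close>)
  show ?cycle using H.cycle_through_two_vertices[OF uv] by blast
qed

section \<open>Separations by two vertices, and induced paths\<close>

definition separation :: "'a set \<Rightarrow> 'a set \<Rightarrow> 'a \<Rightarrow> 'a \<Rightarrow> bool" where
  "separation X Y p q \<longleftrightarrow> V = X \<union> Y \<union> {p, q} \<and> X \<inter> Y = {} \<and> X \<inter> {p, q} = {} \<and> Y \<inter> {p, q} = {} \<and>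
     p \<noteq> q \<and> X \<noteq> {} \<and> Y \<noteq> {} \<and> (\<forall>x\<in>X. \<forall>y\<in>Y. \<not> E x y)"

text \<open>The vertex-list form of \<open>is_chordless_path\<close> for the subgraph induced by
  \<open>S\<close>; \<open>is_chordless_path_induced\<close> links the two.\<close>

definition induces_path :: "'a set \<Rightarrow> 'a list \<Rightarrow> bool" where
  "induces_path S xs \<longleftrightarrow> xs \<noteq> [] \<and> distinct xs \<and> set xs = S \<and>
     (\<forall>x\<in>S. \<forall>y\<in>S. E x y \<longleftrightarrow> (x, y) \<in> set (vwalk_arcs xs) \<or> (y, x) \<in> set (vwalk_arcs xs))"

text \<open>
  Non-adjacency of \<open>p\<close> and \<open>q\<close> and the two \<open>pq\<close>-paths are omitted: in a 2-connected chordless graph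
  they come for free.
\<close>

definition proper_split :: "'a set \<Rightarrow> 'a set \<Rightarrow> 'a \<Rightarrow> 'a \<Rightarrow> bool" where
  "proper_split X Y p q \<longleftrightarrow> separation X Y p q \<and>
     \<not> (\<exists>xs. induces_path (X \<union> {p, q}) xs) \<and> \<not> (\<exists>xs. induces_path (Y \<union> {p, q}) xs)"

lemma separation_swap: "separation X Y p q \<Longrightarrow> separation X Y q p"
  unfolding separation_def by (metis insert_commute)

lemma separation_commute: "separation X Y p q \<Longrightarrow> separation Y X p q"
  unfolding separation_def using adj_sym by (metis Int_commute Un_commute)

lemma separation_adj: "separation X Y p q \<Longrightarrow> E x y \<Longrightarrow> x \<in> X \<Longrightarrow> y \<in> X \<or> y = p \<or> y = q"
  using adj_in[of x y] by (auto simp: separation_def)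

lemma separation_disjoint:
  assumes "separation X Y p q"
  shows "p \<notin> X" "q \<notin> X" "p \<notin> Y" "q \<notin> Y" "p \<noteq> q" "\<And>x. x \<in> X \<Longrightarrow> x \<notin> Y"
  using assms by (auto simp: separation_def)

lemma bridge_disjoint:
  assumes "bridge S u v z"
  shows "u \<in> S" "v \<notin> S" "z \<notin> S" "z \<noteq> v"
  using assms by (auto simp: bridge_def)

lemma bridge_adj_out: "bridge S u v z \<Longrightarrow> E x y \<Longrightarrow> x \<in> S \<Longrightarrow> y \<in> S \<or> y = z \<or> x = u \<and> y = v"
  by (auto simp: bridge_def)

lemma bridge_adj_in: "bridge S u v z \<Longrightarrow> E x y \<Longrightarrow> y \<in> S \<Longrightarrow> x \<in> S \<or> x = z \<or> y = u \<and> x = v"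
  using bridge_adj_out adj_sym by blast

lemma proper_split_swap: "proper_split X Y p q \<Longrightarrow> proper_split X Y q p"
  using separation_swap by (auto simp: proper_split_def insert_commute)

text \<open>A sole neighbour of \<open>x\<close> would be a cut vertex, so every degree is at least
  2.\<close>

lemma ex_other_neighbour:
  assumes "x \<in> V"
  shows "\<exists>y. E x y \<and> y \<noteq> c"
proof -
  \<comment> \<open>The deleted vertex in \<open>cut\<close> must be a vertex other than
    \<open>x\<close>; when \<open>c\<close> is not one, an arbitrary such \<open>c'\<close> stands
    in for it.\<close>
  obtain c' where c': "c' \<in> V" "c' \<noteq> x" "c \<in> V \<and> c \<noteq> x \<longrightarrow> c' = c"
    using ex_third[of x x] by (cases "c \<in> V \<and> c \<noteq> x") auto
  obtain t where "t \<in> V" "t \<noteq> x" "t \<noteq> c'" using ex_third by blast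
  then have "\<exists>u\<in>{x}. \<exists>y\<in>V - insert c' {x}. E u y" using assms c' by (intro cut) auto
  then show ?thesis using c' by auto
qed

text \<open>Otherwise \<open>q\<close> alone would cut \<open>X\<close> off from
  \<open>p\<close>.\<close>

lemma separation_attached:
  assumes "separation X Y p q"
  shows "\<exists>x\<in>X. E p x"
proof -
  have "\<exists>x\<in>X. \<exists>y\<in>V - insert q X. E x y" using assms by (intro cut) (auto simp: separation_def)
  then show ?thesis using assms adj_sym by (auto simp: separation_def)
qed

text \<open>If \<open>q\<close> were not reached, then \<open>p\<close> alone would cut off the part
  \<open>R\<close> of \<open>X\<close> reached from \<open>p\<close>.\<close>

lemma separation_connected:
  assumes "separation X Y p q"
  shows "(\<lambda>x y. E x y \<and> x \<in> X \<union> {p, q} \<and> y \<in> X \<union> {p, q})\<^sup>*\<^sup>* p q" (is "?F\<^sup>*\<^sup>* p q")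
proof (rule ccontr)
  assume neg: "\<not> ?thesis"
  define R where "R = {x \<in> X. ?F\<^sup>*\<^sup>* p x}"
  have step: "?F\<^sup>*\<^sup>* p y" if "?F\<^sup>*\<^sup>* p x" "E x y" "x \<in> X \<union> {p, q}" "y \<in> X \<union> {p, q}" for x y
    using that by (auto intro: rtranclp.rtrancl_into_rtrancl)
  obtain x where "x \<in> X" "E p x" using separation_attached[OF assms] by auto
  then have "x \<in> R" using step[of p x] by (auto simp: R_def)
  then have "\<exists>x\<in>R. \<exists>y\<in>V - insert p R. E x y"
    using assms by (intro cut) (auto simp: R_def separation_def)
  then obtain x y where xy: "x \<in> X" "?F\<^sup>*\<^sup>* p x" "E x y" "y \<in> V" "y \<noteq> p" "y \<notin> R" by (auto simp: R_def)
  have "y \<in> X \<union> {q}" using xy assms by (auto simp: separation_def)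
  moreover have "?F\<^sup>*\<^sup>* p y" using step[OF xy(2,3)] xy \<open>y \<in> X \<union> {q}\<close> by auto
  ultimately show False using neg xy by (auto simp: R_def)
qed

lemma induces_path_rev: "induces_path S xs \<Longrightarrow> induces_path S (rev xs)"
  by (auto simp: induces_path_def set_vwalk_arcs_rev)

lemma induces_path_Cons:
  assumes p: "induces_path S xs" and "a \<notin> S" and hd: "\<And>y. y \<in> S \<Longrightarrow> E a y \<longleftrightarrow> y = hd xs"
  shows "induces_path (insert a S) (a # xs)"
proof -
  have xs: "xs \<noteq> []" "distinct xs" "set xs = S" using p by (auto simp: induces_path_def)
  have no: "(a, y) \<notin> set (vwalk_arcs xs)" "(y, a) \<notin> set (vwalk_arcs xs)" for y
    using in_vwalk_arcsD xs(3) \<open>a \<notin> S\<close> by metis+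
  have "hd xs \<in> S" using xs by auto
  have "E x y \<longleftrightarrow> (x, y) \<in> set (vwalk_arcs (a # xs)) \<or> (y, x) \<in> set (vwalk_arcs (a # xs))"
    if "x \<in> insert a S" "y \<in> insert a S" for x y
  proof (cases "x = a \<or> y = a")
    case True
    then show ?thesis
      using that hd[of x] hd[of y] no adj_irrefl[of a] adj_sym[of x y] adj_sym[of y x] xs
        \<open>a \<notin> S\<close> \<open>hd xs \<in> S\<close> by auto
  next
    case False
    then show ?thesis using that p xs by (auto simp: induces_path_def)
  qed
  then show ?thesis using xs \<open>a \<notin> S\<close> by (simp add: induces_path_def)
qed

lemma induces_path_ConsD:
  assumes p: "induces_path S (a # xs)" and "xs \<noteq> []"
  shows "induces_path (set xs) xs"
proof -
  have xs: "distinct xs" "a \<notin> set xs" "S = insert a (set xs)" using p by (auto simp: induces_path_def)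
  have "E x y \<longleftrightarrow> (x, y) \<in> set (vwalk_arcs xs) \<or> (y, x) \<in> set (vwalk_arcs xs)"
    if "x \<in> set xs" "y \<in> set xs" for x y
  proof -
    have "x \<noteq> a" "y \<noteq> a" using that xs by auto
    then show ?thesis using that p xs \<open>xs \<noteq> []\<close> by (simp add: induces_path_def)
  qed
  then show ?thesis using xs \<open>xs \<noteq> []\<close> by (simp add: induces_path_def)
qed

lemma induces_path_two_neighbours:
  assumes "induces_path S xs" "x \<in> S"
  obtains s t where "\<And>y. y \<in> S \<Longrightarrow> E x y \<Longrightarrow> y = s \<or> y = t"
proof -
  have "x \<in> set xs" using assms by (auto simp: induces_path_def)
  then obtain ys zs where xs: "xs = ys @ x # zs" by (meson split_list)
  have "distinct (ys @ x # zs)" using assms(1) unfolding xs induces_path_def by blast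
  moreover have "(x, y) \<in> set (vwalk_arcs xs) \<or> (y, x) \<in> set (vwalk_arcs xs)" if "y \<in> S" "E x y" for y
    using that assms unfolding induces_path_def by auto
  ultimately have "y = last ys \<or> y = hd zs" if "y \<in> S" "E x y" for y
    using vwalk_arcs_neighbour[of ys x zs y] that unfolding xs by auto
  then show ?thesis using that by blast
qed

text \<open>The first entry has a neighbour in the list on one side only; the last entry is treated
  by reversal.\<close>

lemma induces_path_end_neighbour:
  assumes "induces_path S xs" "x = hd xs \<or> x = last xs"
  obtains s where "\<And>y. y \<in> S \<Longrightarrow> E x y \<Longrightarrow> y = s"
proof -
  have hd: "\<exists>s. \<forall>y\<in>S. E (hd xs) y \<longrightarrow> y = s" if p: "induces_path S xs" for xs
  proof -
    obtain x zs where xs: "xs = [] @ x # zs" using p by (cases xs) (auto simp: induces_path_def)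
    have "distinct ([] @ x # zs)" using p unfolding xs induces_path_def by blast
    moreover have "(x, y) \<in> set (vwalk_arcs xs) \<or> (y, x) \<in> set (vwalk_arcs xs)" if "y \<in> S" "E x y" for y
      using that p unfolding induces_path_def xs by auto
    ultimately have "y = hd zs" if "y \<in> S" "E x y" for y
      using vwalk_arcs_neighbour[of "[]" x zs y] that unfolding xs by auto
    then show ?thesis unfolding xs by auto
  qed
  have "\<exists>s. \<forall>y\<in>S. E x y \<longrightarrow> y = s"
    using assms(2) hd[OF assms(1)] hd[OF induces_path_rev[OF assms(1)]] by (auto simp: hd_rev)
  then show ?thesis using that by blast
qed

text \<open>An end inside \<open>X\<close> would have all its neighbours on the path, hence just
  one, while every degree is at least 2. So the ends are \<open>p\<close> and \<open>q\<close>, in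
  one order or the other.\<close>

lemma separation_induces_path_ends:
  assumes "separation X Y p q" "induces_path (X \<union> {p, q}) xs"
  obtains ys where "induces_path (X \<union> {p, q}) ys" "hd ys = p" "last ys = q"
proof -
  have end_in: "x \<in> {p, q}" if x: "x = hd xs \<or> x = last xs" for x
  proof (rule ccontr)
    assume "x \<notin> {p, q}"
    moreover have "x \<in> set xs" using x assms(2) by (auto simp: induces_path_def)
    ultimately have "x \<in> X" using assms(2) by (auto simp: induces_path_def)
    obtain s where s: "\<And>y. y \<in> X \<union> {p, q} \<Longrightarrow> E x y \<Longrightarrow> y = s"
      using induces_path_end_neighbour[OF assms(2) x] by blast
    obtain y where y: "E x y" "y \<noteq> s" using ex_other_neighbour \<open>x \<in> X\<close> assms(1)
      by (metis UnI1 separation_def)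
    have "y \<in> X \<union> {p, q}" using y \<open>x \<in> X\<close> assms(1) adj_in[OF y(1)] by (auto simp: separation_def)
    then show False using s y by blast
  qed
  have "hd xs \<noteq> last xs"
  proof
    assume eq: "hd xs = last xs"
    then have "length xs = 1" using assms(2)
      by (cases xs) (auto simp: induces_path_def split: if_splits)
    then show False using assms by (cases xs) (auto simp: induces_path_def separation_def)
  qed
  then consider "hd xs = p" "last xs = q" | "hd xs = q" "last xs = p" using end_in by blast
  then show ?thesis
  proof cases
    case 1 then show ?thesis using that assms by blast
  next
    case 2
    moreover have "xs \<noteq> []" using assms by (auto simp: induces_path_def)
    ultimately show ?thesis using that[OF induces_path_rev[OF assms(2)]] by (simp add: hd_rev last_rev)
  qed
qed

lemma bridge_complement:
  assumes "bridge S u v z"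
  shows "bridge (V - S - {z}) v u z"
proof -
  have "y \<in> V - S - {z} \<or> y = z \<or> x = v \<and> y = u" if "E x y" "x \<in> V - S - {z}" for x y
    using bridge_adj_in[OF assms that(1)] adj_in[OF that(1)] that by auto
  then show ?thesis using assms unfolding bridge_def by auto
qed

end

section \<open>Proper splits when every edge is a bridge after deleting a vertex\<close>

locale bridged_biconnected = biconnected +
  assumes ex_bridge: "E u v \<Longrightarrow> \<exists>S z. bridge S u v z"
begin

text \<open>An edge \<open>pq\<close> would be a bridge of the graph minus some \<open>t\<close>,
  but the side of the separation without \<open>t\<close> also joins \<open>p\<close> to
  \<open>q\<close>.\<close>

lemma separation_nonadjacent:
  assumes sep: "separation X Y p q"
  shows "\<not> E p q"
proof
  assume "E p q"
  then obtain T t where T: "bridge T p q t" using ex_bridge by blast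
  have False if sep: "separation X Y p q" and t: "t \<in> X" for X Y
  proof -
    \<comment> \<open>Otherwise \<open>p\<close> would be a cut vertex: an edge from this set can
      leave \<open>Y\<close> only to \<open>p\<close> or \<open>q\<close>, and can leave
      \<open>T\<close> only to \<open>t\<close>, which lies in \<open>X\<close>.\<close>
    have "Y \<inter> T = {}"
    proof (rule ccontr)
      assume "Y \<inter> T \<noteq> {}"
      then have "\<exists>x\<in>Y \<inter> T. \<exists>y\<in>V - insert p (Y \<inter> T). E x y"
        using sep T by (intro cut) (auto simp: separation_def bridge_def)
      then obtain x y where xy: "x \<in> Y" "x \<in> T" "E x y" "y \<in> V" "y \<noteq> p" "y \<notin> Y \<or> y \<notin> T" by auto
      show False
        using separation_adj[OF separation_commute[OF sep] xy(3,1)] bridge_adj_out[OF T xy(3,2)] xy t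
          separation_disjoint[OF sep] bridge_disjoint[OF T]
        by blast
    qed
    have "\<exists>x\<in>Y. \<exists>y\<in>V - insert q Y. E x y"
      using sep by (intro cut) (auto simp: separation_def)
    then obtain x y where xy: "x \<in> Y" "E x y" "y \<in> V" "y \<noteq> q" "y \<notin> Y" by auto
    then have "y = p" using separation_adj[OF separation_commute[OF sep] xy(2,1)] by auto
    then have "y \<in> T" using bridge_disjoint[OF T] by blast
    then show False
      using bridge_adj_in[OF T xy(2)] xy t \<open>Y \<inter> T = {}\<close> separation_disjoint[OF sep] by blast
  qed
  moreover have "t \<in> X \<or> t \<in> Y" using T sep by (auto simp: separation_def bridge_def)
  ultimately show False using sep separation_commute by blast
qed

text \<open>On the side of \<open>u\<close>, an induced path would end in \<open>u\<close>, but
  \<open>u\<close> keeps two neighbours there: only \<open>v\<close> is lost, as \<open>u\<close>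
  and \<open>z\<close> are not adjacent. On the other side \<open>v\<close> keeps all its
  neighbours, at least three.\<close>

lemma bridge_proper_split:
  assumes b: "bridge S u v z" and u: "3 \<le> card {y. E u y}" and v: "3 \<le> card {y. E v y}"
  shows "proper_split (S - {u}) (V - S - {z}) u z"
proof -
  obtain n where n: "E u n" "n \<noteq> v" "n \<noteq> z" using ex_avoiding_two[OF u] by blast
  then have nS: "n \<in> S" "n \<noteq> u" using b adj_irrefl by (auto simp: bridge_def)
  have sep: "separation (S - {u}) (V - S - {z}) u z"
  proof -
    have "\<not> E x y" if "x \<in> S - {u}" "y \<in> V - S - {z}" for x y
      using bridge_adj_out[OF b, of x y] that by auto
    then show ?thesis using b nS unfolding separation_def bridge_def by auto
  qed
  have nuz: "\<not> E u z" using separation_nonadjacent[OF sep] .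
  have "\<not> induces_path (S - {u} \<union> {u, z}) xs" for xs
  proof
    assume "induces_path (S - {u} \<union> {u, z}) xs"
    then obtain ys where ys: "induces_path (S - {u} \<union> {u, z}) ys" "hd ys = u"
      using separation_induces_path_ends[OF sep] by blast
    obtain s where s: "\<And>y. y \<in> S - {u} \<union> {u, z} \<Longrightarrow> E u y \<Longrightarrow> y = s"
      using induces_path_end_neighbour[OF ys(1)] ys(2) by metis
    obtain m where m: "E u m" "m \<noteq> v" "m \<noteq> n" using ex_avoiding_two[OF u] by blast
    then have "m \<in> S" using nuz b by (auto simp: bridge_def)
    then show False using s[of m] s[of n] m n nS by auto
  qed
  moreover have "\<not> induces_path (V - S - {z} \<union> {u, z}) xs" for xs
  proof
    assume p: "induces_path (V - S - {z} \<union> {u, z}) xs"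
    obtain s t where st: "\<And>y. y \<in> V - S - {z} \<union> {u, z} \<Longrightarrow> E v y \<Longrightarrow> y = s \<or> y = t"
      using induces_path_two_neighbours[OF p, of v] b by (auto simp: bridge_def)
    obtain m where m: "E v m" "m \<noteq> s" "m \<noteq> t" using ex_avoiding_two[OF v] by blast
    have "m \<in> V - S - {z} \<union> {u, z}" using bridge_adj_in[OF b m(1)] b adj_in[OF m(1)] by (auto simp: bridge_def)
    then show False using st m by blast
  qed
  ultimately show ?thesis using sep by (simp add: proper_split_def)
qed

text \<open>An induced path on the new smaller side would extend by \<open>a\<close> to one on the
  old side of \<open>X\<close>. One on the new larger side would, after removing its end
  \<open>a'\<close>, give one on the old side of \<open>Y\<close>.\<close>

lemma unique_neighbour_proper_split:
  assumes s: "proper_split X Y a b" and a': "a' \<in> X" "E a a'" and uniq: "\<And>x. x \<in> X \<Longrightarrow> E a x \<Longrightarrow> x = a'"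
  shows "proper_split (X - {a'}) (insert a Y) a' b"
proof -
  have sep: "separation X Y a b" using s by (simp add: proper_split_def)
  have nab: "\<not> E a b" using separation_nonadjacent[OF sep] .
  have dist: "a \<noteq> b" "a' \<noteq> a" "a' \<noteq> b" "a \<notin> X" "b \<notin> X" "a \<notin> Y" "b \<notin> Y" "a' \<notin> Y"
    using sep a' by (auto simp: separation_def)
  have "X \<noteq> {a'}"
  proof
    assume X: "X = {a'}"
    then have "E a' b" using separation_attached[OF separation_swap[OF sep]] adj_sym by auto
    then have "induces_path (X \<union> {a, b}) [a, a', b]"
      using X dist nab a' adj_sym adj_irrefl by (auto simp: induces_path_def)
    then show False using s by (auto simp: proper_split_def)
  qed
  then have sep': "separation (X - {a'}) (insert a Y) a' b"
  proof -
    have "\<not> E x y" if "x \<in> X - {a'}" "y \<in> insert a Y" for x y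
      using that uniq[of x] adj_sym[of x y] sep by (auto simp: separation_def)
    then show ?thesis using sep a' dist \<open>X \<noteq> {a'}\<close> unfolding separation_def by auto
  qed
  have "\<not> induces_path (X - {a'} \<union> {a', b}) xs" for xs
  proof
    assume "induces_path (X - {a'} \<union> {a', b}) xs"
    then obtain ys where ys: "induces_path (X - {a'} \<union> {a', b}) ys" "hd ys = a'"
      using separation_induces_path_ends[OF sep'] by blast
    have "X - {a'} \<union> {a', b} = insert b X" using a' by auto
    with ys have ys': "induces_path (insert b X) ys" by simp
    have "E a y \<longleftrightarrow> y = a'" if "y \<in> insert b X" for y
      using that uniq[of y] nab a' by blast
    then have "induces_path (insert a (insert b X)) (a # ys)"
      using induces_path_Cons[OF ys'] ys(2) dist by simp
    then have "induces_path (X \<union> {a, b}) (a # ys)" by simp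
    then show False using s unfolding proper_split_def by blast
  qed
  moreover have "\<not> induces_path (insert a Y \<union> {a', b}) xs" for xs
  proof
    assume "induces_path (insert a Y \<union> {a', b}) xs"
    then obtain ys where ys: "induces_path (insert a Y \<union> {a', b}) ys" "hd ys = a'"
      using separation_induces_path_ends[OF separation_commute[OF sep']] by blast
    then obtain zs where zs: "ys = a' # zs" by (cases ys) (auto simp: induces_path_def)
    have *: "set (a' # zs) = insert a Y \<union> {a', b}" "distinct (a' # zs)"
      using ys(1) unfolding zs induces_path_def by blast+
    have "set zs = set (a' # zs) - {a'}" using *(2) by auto
    also have "\<dots> = Y \<union> {a, b}" unfolding *(1) using dist by blast
    finally have "set zs = Y \<union> {a, b}" .
    moreover have "zs \<noteq> []" using \<open>set zs = Y \<union> {a, b}\<close> by force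
    ultimately have "induces_path (Y \<union> {a, b}) zs"
      using induces_path_ConsD[OF ys(1)[unfolded zs]] by simp
    then show False using s unfolding proper_split_def by blast
  qed
  ultimately show ?thesis using sep' by (simp add: proper_split_def)
qed

section \<open>Splits with a smallest possible \<open>X\<close>\<close>

context
  fixes X Y a b
  assumes split: "proper_split X Y a b"
    and minimal: "\<And>X' Y' a' b'. proper_split X' Y' a' b' \<Longrightarrow> card X \<le> card X'"
begin

lemma finite_X: "finite X"
proof -
  have "finite V" using card_V by (intro card_ge_0_finite) simp
  then show ?thesis using split by (auto simp: proper_split_def separation_def)
qed

lemma minimal_two_neighbours: "2 \<le> card {x \<in> X. E a x}"
proof (rule ccontr)
  assume "\<not> ?thesis"
  then have "card {x \<in> X. E a x} \<le> 1" by simp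
  obtain a' where a': "a' \<in> X" "E a a'"
    using separation_attached[of X Y a b] split by (auto simp: proper_split_def)
  have "x = a'" if "x \<in> X" "E a x" for x
    using card_le_Suc0_iff_eq[of "{x \<in> X. E a x}"] \<open>card _ \<le> 1\<close> that a' finite_X by simp
  then have "proper_split (X - {a'}) (insert a Y) a' b"
    using unique_neighbour_proper_split[OF split a'] by blast
  then have "card X \<le> card (X - {a'})" by (rule minimal)
  then show False using a' finite_X by (metis card_Diff1_less leD)
qed

text \<open>The resulting split has the side \<open>S - {u}\<close>, which is smaller than
  \<open>X\<close> even when \<open>S\<close> equals \<open>X\<close>.\<close>

lemma minimal_no_inner_bridge:
  assumes "bridge S u v z" "S \<subseteq> X" "3 \<le> card {y. E u y}" "3 \<le> card {y. E v y}"
  shows False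
proof -
  have "card X \<le> card (S - {u})" using minimal[OF bridge_proper_split[OF assms(1,3,4)]] .
  also have "\<dots> < card S" using assms(1,2) finite_X
    by (intro card_Diff1_less) (auto simp: bridge_def finite_subset)
  also have "\<dots> \<le> card X" using assms(2) finite_X by (rule card_mono[rotated])
  finally show False by simp
qed

end

text \<open>An edge from \<open>S \<inter> X\<close> that leaves \<open>X\<close> ends in
  \<open>a\<close> or \<open>b\<close>, hence outside \<open>S\<close>, so the bridge condition on
  \<open>S\<close> already covers it.\<close>

lemma bridge_restrict:
  assumes sep: "separation X Y a b" and br: "bridge S u v z" and "a \<notin> S" "b \<notin> S" "u \<in> X \<union> {a, b}"
  shows "bridge (S \<inter> X) u v z"
proof -
  have "y \<in> S \<inter> X \<or> y = z \<or> x = u \<and> y = v" if "E x y" "x \<in> S \<inter> X" for x y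
    using separation_adj[OF sep that(1)] bridge_adj_out[OF br that(1)] that assms by auto
  then show ?thesis using assms unfolding bridge_def by auto
qed

text \<open>No edge joins \<open>X\<close> to \<open>z\<close> in \<open>Y\<close>, so the exit
  through \<open>z\<close> disappears; the vertex \<open>a\<close>, dropped from the side, becomes
  the new exit.\<close>

lemma crossing_bridge_restrict:
  assumes "separation X Y a b" "bridge S u v z" "a \<in> S" "b \<notin> S" "z \<in> Y" "u \<in> X"
  shows "bridge (S \<inter> X) u v a"
proof -
  have "y \<in> S \<inter> X \<or> y = a \<or> x = u \<and> y = v" if "E x y" "x \<in> S \<inter> X" for x y
    using separation_adj[OF assms(1) that(1)] bridge_adj_out[OF assms(2) that(1)] that assms
    by (auto simp: separation_def)
  moreover have "a \<notin> X" "z \<notin> X" using assms by (auto simp: separation_def)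
  ultimately show ?thesis using assms unfolding bridge_def by auto
qed

text \<open>The sides of the bridge separate \<open>a\<close> from \<open>b\<close>, yet
  \<open>Y\<close> connects them without using \<open>uv\<close>; hence \<open>z\<close> must block
  the connection inside \<open>Y\<close>.\<close>

lemma crossing_bridge_pivot:
  assumes sep: "separation X Y a b" and br: "bridge S u v z" and ab: "a \<in> S" "b \<notin> S" "z \<noteq> b"
    and uv: "u \<in> X \<union> {a, b}" "v \<in> X \<union> {a, b}"
  shows "z \<in> Y"
proof (rule ccontr)
  assume "z \<notin> Y"
  have "Y \<inter> S = {}"
  proof (rule ccontr)
    assume "Y \<inter> S \<noteq> {}"
    then have "\<exists>x\<in>Y \<inter> S. \<exists>y\<in>V - insert a (Y \<inter> S). E x y"
      using sep br ab by (intro cut) (auto simp: separation_def bridge_def)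
    then obtain x y where xy: "x \<in> Y" "x \<in> S" "E x y" "y \<in> V" "y \<noteq> a" "y \<notin> Y \<or> y \<notin> S" by auto
    show False
      using separation_adj[OF separation_commute[OF sep] xy(3,1)] bridge_adj_out[OF br xy(3,2)]
        xy ab uv \<open>z \<notin> Y\<close> separation_disjoint[OF sep] bridge_disjoint[OF br]
      by blast
  qed
  have "\<exists>x\<in>Y. \<exists>y\<in>V - insert b Y. E x y"
    using sep br ab by (intro cut) (auto simp: separation_def bridge_def)
  then obtain x y where xy: "x \<in> Y" "E x y" "y \<in> V" "y \<noteq> b" "y \<notin> Y" by auto
  then have "y = a" using separation_adj[OF separation_commute[OF sep] xy(2,1)] by auto
  then show False
    using bridge_adj_in[OF br xy(2)] xy ab uv \<open>z \<notin> Y\<close> \<open>Y \<inter> S = {}\<close> separation_disjoint[OF sep]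
    by blast
qed

lemma minimal_edge_sparse:
  assumes split: "proper_split X Y a b"
    and minimal: "\<And>X' Y' a' b'. proper_split X' Y' a' b' \<Longrightarrow> card X \<le> card X'"
    and "E u v" and uv: "u \<in> X \<union> {a, b}" "v \<in> X \<union> {a, b}"
    and deg: "3 \<le> card {y. E u y}" "3 \<le> card {y. E v y}"
  shows False
proof -
  have sep: "separation X Y a b" using split by (simp add: proper_split_def)
  have nab: "\<not> E a b" "\<not> E b a" using separation_nonadjacent[OF sep] adj_sym by auto
  have inner: False
    if "bridge S u v z" "S \<subseteq> X" "3 \<le> card {y. E u y}" "3 \<le> card {y. E v y}" for S u v z
    using minimal_no_inner_bridge[OF split _ that] minimal by blast
  obtain S z where br: "bridge S u v z" using ex_bridge \<open>E u v\<close> by blast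
  define D where "D = V - S - {z}"
  have br': "bridge D v u z" using bridge_complement[OF br] by (simp add: D_def)
  \<comment> \<open>Stated for arbitrary \<open>a\<close>, \<open>b\<close>, \<open>S\<close>,
    \<open>D\<close>, \<open>u\<close>, \<open>v\<close>, so that it applies again with
    \<open>a\<close> and \<open>b\<close> exchanged.\<close>
  have crossing: False
    if sep: "separation X Y a b" and nab: "\<not> E a b" and br: "bridge S u v z" and br': "bridge D v u z"
      and ab: "a \<in> S" "b \<in> D" and D: "D = V - S - {z}" and "E u v"
      and uv: "u \<in> X \<union> {a, b}" "v \<in> X \<union> {a, b}"
      and deg: "3 \<le> card {y. E u y}" "3 \<le> card {y. E v y}" for a b S D u v
  proof -
    have zY: "z \<in> Y" using crossing_bridge_pivot[OF sep br ab(1) _ _ uv] ab D by auto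
    show False
    proof (cases "u = a")
      case False
      then have "u \<in> X" using uv ab D br by (auto simp: bridge_def)
      from crossing_bridge_restrict[OF sep br ab(1) _ zY this] ab D
      show False using inner deg by blast
    next
      case True
      \<comment> \<open>As \<open>u\<close> is \<open>a\<close>, it is not in \<open>X\<close>; the
        bridge is therefore taken from the side \<open>D\<close> of \<open>v\<close>, with
        \<open>b\<close> as the new exit.\<close>
      then have "v \<in> X" using uv nab \<open>E u v\<close> adj_irrefl by auto
      from crossing_bridge_restrict[OF separation_swap[OF sep] br' ab(2) _ zY this] ab D
      show False using inner deg by blast
    qed
  qed
  have V: "a \<in> V" "b \<in> V" using sep by (auto simp: separation_def)
  \<comment> \<open>Since \<open>z\<close> may be \<open>a\<close> or \<open>b\<close>, one of them
    may lie in neither \<open>S\<close> nor \<open>D\<close>; this falls under the first two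
    cases.\<close>
  consider "a \<notin> S" "b \<notin> S" | "a \<notin> D" "b \<notin> D" | "a \<in> S" "b \<in> D" | "b \<in> S" "a \<in> D"
    using V by (auto simp: D_def)
  then show False
  proof cases
    case 1
    from bridge_restrict[OF sep br this uv(1)] show False using inner deg by blast
  next
    case 2
    from bridge_restrict[OF sep br' this uv(2)] show False using inner deg by blast
  next
    case 3
    from crossing[OF sep nab(1) br br' this D_def \<open>E u v\<close> uv deg] show False .
  next
    case 4
    from crossing[OF separation_swap[OF sep] nab(2) br br' this D_def \<open>E u v\<close>] uv deg
    show False by auto
  qed
qed

end

section \<open>Translation between library digraphs and vertex lists\<close>

lemma connected_crossing_arc:
  assumes "Digraph_Component.connected H" "x \<in> A" "x \<in> verts H" "y \<in> verts H" "y \<notin> A"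
  shows "\<exists>s\<in>A. \<exists>t\<in>verts H - A. (s, t) \<in> parcs (mk_symmetric H)"
proof (rule ccontr)
  assume neg: "\<not> ?thesis"
  have "x \<rightarrow>\<^sup>*\<^bsub>with_proj (mk_symmetric H)\<^esub> y"
    using assms by (auto simp: connected_def strongly_connected_def mk_symmetric_def)
  then have "(x, y) \<in> rtrancl_on (verts H) (parcs (mk_symmetric H))"
    by (simp add: reachable_def)
  then have "y \<in> A"
  proof (induction rule: rtrancl_on_induct)
    case (step t z)
    then show ?case using neg by blast
  qed (use assms in auto)
  with assms show False by simp
qed

lemma pawalk_verts_vwalk_arcs:
  "xs \<noteq> [] \<Longrightarrow> pawalk_verts (hd xs) (vwalk_arcs xs) = xs"
  by (induction xs rule: vwalk_arcs.induct) auto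

lemma pcas_vwalk_arcs: "xs \<noteq> [] \<Longrightarrow> pcas (hd xs) (vwalk_arcs xs) (last xs)"
  by (induction xs rule: vwalk_arcs.induct) auto

lemma vwalk_arcs_pawalk_verts: "pcas u p v \<Longrightarrow> vwalk_arcs (pawalk_verts u p) = p"
proof (induction p arbitrary: u)
  case (Cons e p)
  then have "hd (pawalk_verts (snd e) p) = snd e" by (cases p) auto
  moreover have "pawalk_verts (snd e) p \<noteq> []" by (cases p) auto
  ultimately show ?case using Cons by (auto simp: prod_eq_iff)
qed simp

lemma successively_iff_vwalk_arcs: "successively P xs \<longleftrightarrow> (\<forall>(x, y)\<in>set (vwalk_arcs xs). P x y)"
  by (induction xs rule: vwalk_arcs.induct) auto

lemma walk_edges_with_proj: "walk_edges (with_proj H) p = set p \<union> (set p)\<inverse>"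
  by (auto simp: walk_edges_def arc_to_ends_def)

text \<open>A path given by its arcs and one given by its vertices determine each other through
  \<open>pawalk_verts\<close> and \<open>vwalk_arcs\<close>.\<close>

lemma is_chordless_path_with_proj:
  "is_chordless_path (with_proj H) \<longleftrightarrow> (\<exists>xs. xs \<noteq> [] \<and> distinct xs \<and> set xs = pverts H \<and>
     parcs H = set (vwalk_arcs xs) \<union> (set (vwalk_arcs xs))\<inverse>)" (is "?L \<longleftrightarrow> ?R")
proof
  assume ?L
  then obtain u p v where p: "pcas u p v" "distinct (pawalk_verts u p)" "pverts H = set (pawalk_verts u p)"
    "parcs H = set p \<union> (set p)\<inverse>"
    by (auto simp: is_chordless_path_def pre_digraph.apath_def pre_digraph.awalk_def
        cas_with_proj_eq awalk_verts_with_proj_eq walk_edges_with_proj)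
  moreover have "pawalk_verts u p \<noteq> []" by (cases p) auto
  ultimately show ?R
    using vwalk_arcs_pawalk_verts[OF p(1)] by (intro exI[of _ "pawalk_verts u p"]) simp
next
  assume ?R
  then obtain xs where xs: "xs \<noteq> []" "distinct xs" "set xs = pverts H"
    "parcs H = set (vwalk_arcs xs) \<union> (set (vwalk_arcs xs))\<inverse>" by blast
  moreover have "hd xs \<in> pverts H" using xs(1) unfolding xs(3)[symmetric] by (rule hd_in_set)
  ultimately show ?L
    unfolding is_chordless_path_def pre_digraph.apath_def pre_digraph.awalk_def
      cas_with_proj_eq awalk_verts_with_proj_eq walk_edges_with_proj
    by (intro exI[of _ "hd xs"] exI[of _ "vwalk_arcs xs"] exI[of _ "last xs"])
      (simp add: pcas_vwalk_arcs pawalk_verts_vwalk_arcs)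
qed

definition induced :: "'a pair_pre_digraph \<Rightarrow> 'a set \<Rightarrow> 'a pair_pre_digraph" where
  "induced G S = \<lparr>pverts = S, parcs = {e \<in> parcs G. fst e \<in> S \<and> snd e \<in> S}\<rparr>"

lemma induce_subgraph_with_proj: "with_proj G \<restriction> S = with_proj (induced G S)"
  by (simp add: induce_subgraph_def with_proj_def induced_def)

section \<open>2-connected chordless graphs as an instance\<close>

locale chordless_graph = pair_graph G for G :: "'a pair_pre_digraph" +
  assumes two_conn: "two_connected (with_proj G)" and chordless: "chordless (with_proj G)"
begin

definition adj :: "'a \<Rightarrow> 'a \<Rightarrow> bool" where "adj x y \<longleftrightarrow> (x, y) \<in> parcs G"

sublocale biconnected "pverts G" adj
proof
  show "x \<in> pverts G \<and> y \<in> pverts G" if "adj x y" for x y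
    using that wellformed' by (auto simp: adj_def)
  show "adj y x" if "adj x y" for x y using that arcs_symmetric by (auto simp: adj_def)
  show "\<not> adj x x" for x using pair_no_loops by (force simp: adj_def)
  show "3 \<le> card (pverts G)" using two_conn by (simp add: two_connected_def)
  show "\<exists>x\<in>A. \<exists>y\<in>pverts G - insert c A. adj x y"
    if A: "A \<subseteq> pverts G" "A \<noteq> {}" "c \<in> pverts G" "c \<notin> A" "\<not> pverts G \<subseteq> insert c A" for A c
  proof -
    let ?H = "pre_digraph.del_vert (with_proj G) c"
    obtain x y where xy: "x \<in> A" "y \<in> pverts G" "y \<notin> A" "y \<noteq> c" using A by auto
    have "Digraph_Component.connected ?H" using two_conn A by (simp add: two_connected_def)
    from connected_crossing_arc[OF this, of x A y]
    obtain s t where st: "s \<in> A" "t \<in> pverts G" "t \<noteq> c" "t \<notin> A" "(s, t) \<in> parcs (mk_symmetric ?H)"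
      using xy A by (auto simp: pre_digraph.del_vert_def)
    then have "(s, t) \<in> parcs G \<or> (t, s) \<in> parcs G"
      by (auto simp: mk_symmetric_def pre_digraph.del_vert_def)
    then have "adj s t" using arcs_symmetric by (auto simp: adj_def)
    with st show ?thesis by blast
  qed
qed

lemma list_cycle_ucycle:
  assumes "list_cycle adj xs"
  shows "ucycle (with_proj G) (vwalk_arcs (xs @ [hd xs]))"
proof -
  have xs: "3 \<le> length xs" "distinct xs" "successively adj xs" "adj (last xs) (hd xs)" "xs \<noteq> []"
    using assms by (auto simp: list_cycle_def)
  \<comment> \<open>A library cycle visits its start again at the end, so the head is
    appended.\<close>
  let ?ys = "xs @ [hd xs]"
  have hd: "hd ?ys = hd xs" using xs by simp
  have "successively adj ?ys" using xs by (simp add: successively_append_iff)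
  then have "set (vwalk_arcs ?ys) \<subseteq> parcs G" by (auto simp: successively_iff_vwalk_arcs adj_def)
  moreover have "hd xs \<in> pverts G" using xs(4) adj_in by blast
  moreover have "pcas (hd xs) (vwalk_arcs ?ys) (hd xs)" using pcas_vwalk_arcs[of ?ys] hd by simp
  moreover have "pawalk_verts (hd xs) (vwalk_arcs ?ys) = ?ys"
    using pawalk_verts_vwalk_arcs[of ?ys] hd by simp
  moreover have "distinct (tl ?ys)" using xs by (cases xs) auto
  moreover have "length (vwalk_arcs ?ys) = length xs"
    using vwalk_length_simp[of ?ys] unfolding vwalk_length_def by (simp del: vwalk_length_simp)
  ultimately show ?thesis
    using xs(1) unfolding ucycle_def pre_digraph.cycle_def pre_digraph.awalk_def
      cas_with_proj_eq awalk_verts_with_proj_eq by (auto intro!: exI[of _ "hd xs"])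
qed

text \<open>Chordlessness rules out the first alternative of \<open>cycle_or_bridge\<close>, since
  \<open>uv\<close> would be a chord of that cycle.\<close>

sublocale bridged_biconnected "pverts G" adj
proof
  fix u v assume uv: "adj u v"
  have "\<not> list_cycle (\<lambda>x y. adj x y \<and> {x, y} \<noteq> {u, v}) xs" if "u \<in> set xs" "v \<in> set xs" for xs
  proof
    assume cyc: "list_cycle (\<lambda>x y. adj x y \<and> {x, y} \<noteq> {u, v}) xs"
    let ?ys = "xs @ [hd xs]"
    have "xs \<noteq> []" using that by auto
    have "list_cycle adj xs"
      using cyc successively_mono[of "\<lambda>x y. adj x y \<and> {x, y} \<noteq> {u, v}" xs adj]
      unfolding list_cycle_def by blast
    then have "ucycle (with_proj G) (vwalk_arcs ?ys)" by (rule list_cycle_ucycle)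
    moreover have "successively (\<lambda>x y. adj x y \<and> {x, y} \<noteq> {u, v}) ?ys"
      using cyc \<open>xs \<noteq> []\<close> by (simp add: list_cycle_def successively_append_iff)
    then have "(u, v) \<notin> walk_edges (with_proj G) (vwalk_arcs ?ys)"
      by (auto simp: walk_edges_with_proj successively_iff_vwalk_arcs)
    moreover have "fst ` set (vwalk_arcs ?ys) = set xs"
    proof -
      have "map fst (vwalk_arcs (zs @ [z])) = zs" for zs and z :: 'a
        by (induction zs rule: vwalk_arcs.induct) auto
      then show ?thesis by (metis list.set_map)
    qed
    ultimately have "cycle_chord (with_proj G) (vwalk_arcs ?ys) u v"
      using that uv by (auto simp: cycle_chord_def adj_def)
    with \<open>ucycle _ _\<close> chordless show False by (auto simp: chordless_def)
  qed
  then show "\<exists>S z. bridge S u v z" using cycle_or_bridge[OF uv] by blast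
qed

lemma is_chordless_path_induced:
  "is_chordless_path (with_proj G \<restriction> S) \<longleftrightarrow> (\<exists>xs. induces_path S xs)"
proof -
  have arcs_eq: "parcs (induced G S) = R \<union> R\<inverse> \<longleftrightarrow>
      (\<forall>x\<in>S. \<forall>y\<in>S. adj x y \<longleftrightarrow> (x, y) \<in> R \<or> (y, x) \<in> R)" if "R \<subseteq> S \<times> S" for R
    using that by (auto simp: induced_def adj_def set_eq_iff)
  have "(xs \<noteq> [] \<and> distinct xs \<and> set xs = pverts (induced G S) \<and>
      parcs (induced G S) = set (vwalk_arcs xs) \<union> (set (vwalk_arcs xs))\<inverse>) \<longleftrightarrow> induces_path S xs" for xs
  proof (cases "set xs = S")
    case True
    have "set (vwalk_arcs xs) \<subseteq> set xs \<times> set xs" by (auto dest: in_vwalk_arcsD)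
    then have "set (vwalk_arcs xs) \<subseteq> S \<times> S" unfolding True .
    note arcs_eq[OF this]
    moreover have "pverts (induced G S) = S" by (simp add: induced_def)
    ultimately show ?thesis using True by (simp only: induces_path_def simp_thms)
  next
    case False
    then show ?thesis by (simp add: induces_path_def induced_def)
  qed
  then show ?thesis
    unfolding induce_subgraph_with_proj is_chordless_path_with_proj by simp
qed

text \<open>The conjuncts that \<open>proper_split\<close> omits come from 2-connectivity,
  \<open>separation_nonadjacent\<close> and \<open>separation_connected\<close>, the last applied to
  both sides.\<close>

lemma proper_2_cutset_split_iff:
  "proper_2_cutset_split (with_proj G) X Y a b \<longleftrightarrow> proper_split X Y a b"
proof
  assume "proper_2_cutset_split (with_proj G) X Y a b"
  then show "proper_split X Y a b"
    unfolding proper_2_cutset_split_def proper_split_def separation_def is_chordless_path_induced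
    by (simp add: adj_def)
next
  assume s: "proper_split X Y a b"
  then have sep: "separation X Y a b" by (simp add: proper_split_def)
  have path: "\<exists>p. pre_digraph.apath (with_proj G \<restriction> (X \<union> {a, b})) a p b"
    if sep: "separation X Y a b" for X Y
  proof -
    let ?S = "X \<union> {a, b}"
    from rtranclp_imp_distinct_list[OF separation_connected[OF sep]] obtain xs where
      xs: "xs \<noteq> []" "hd xs = a" "last xs = b" "distinct xs"
      "successively (\<lambda>x y. adj x y \<and> x \<in> ?S \<and> y \<in> ?S) xs" by blast
    have "set (vwalk_arcs xs) \<subseteq> parcs (induced G ?S)"
      using xs(5) by (auto simp: successively_iff_vwalk_arcs adj_def induced_def)
    moreover have "a \<in> pverts (induced G ?S)" by (simp add: induced_def)
    ultimately show ?thesis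
      unfolding induce_subgraph_with_proj pre_digraph.apath_def pre_digraph.awalk_def
        cas_with_proj_eq awalk_verts_with_proj_eq
      using xs pcas_vwalk_arcs[OF xs(1)] pawalk_verts_vwalk_arcs[OF xs(1)]
      by (intro exI[of _ "vwalk_arcs xs"]) simp
  qed
  have "\<not> adj a b" using separation_nonadjacent[OF sep] .
  moreover have "Digraph_Component.connected (with_proj G)" using two_conn by (simp add: two_connected_def)
  ultimately show "proper_2_cutset_split (with_proj G) X Y a b"
    using path[OF sep] path[OF separation_commute[OF sep]] s
    unfolding proper_2_cutset_split_def proper_split_def separation_def is_chordless_path_induced
    by (simp add: adj_def)
qed

end

section \<open>Degrees in the block, and the theorem\<close>

lemma out_degree_with_proj: "out_degree (with_proj H) x = card {y. (x, y) \<in> parcs H}"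
proof -
  have "out_arcs (with_proj H) x = Pair x ` {y. (x, y) \<in> parcs H}"
    by (auto simp: out_arcs_def)
  then show ?thesis by (simp add: out_degree_def card_image inj_on_def)
qed

theorem theorem3:
  fixes G :: "'a pair_pre_digraph" and X Y :: "'a set" and a b :: 'a
  assumes "pair_graph G"
    and "two_connected G"
    and "chordless G"
    and "\<not> two_sparse G"
    and "proper_2_cutset_split G X Y a b"
    and "\<And>X' Y' a' b'. proper_2_cutset_split G X' Y' a' b' \<Longrightarrow> card X \<le> card X'"
  shows "2 \<le> card {v \<in> X. a \<rightarrow>\<^bsub>G\<^esub> v} \<and> 2 \<le> card {v \<in> X. b \<rightarrow>\<^bsub>G\<^esub> v} \<and>
    two_sparse (block G X a b)"
proof -
  interpret pair_graph G by fact
  interpret chordless_graph G using assms by unfold_locales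
  have s: "proper_split X Y a b" using assms(5) by (simp add: proper_2_cutset_split_iff)
  have s': "proper_split X Y b a" using proper_split_swap[OF s] .
  have sep: "separation X Y a b" using s by (simp add: proper_split_def)
  have min: "card X \<le> card X'" if "proper_split X' Y' a' b'" for X' Y' a' b'
    using assms(6) that by (simp add: proper_2_cutset_split_iff)
  have a2: "2 \<le> card {v \<in> X. adj a v}" using minimal_two_neighbours[OF s] min by blast
  have b2: "2 \<le> card {v \<in> X. adj b v}" using minimal_two_neighbours[OF s'] min by blast
  have fin: "finite {y. adj x y}" for x
    using finite_subset[OF _ pair_finite_verts, of "{y. adj x y}"] adj_in by blast
  \<comment> \<open>Besides its two neighbours in \<open>X\<close>, the vertex \<open>p\<close> has
    one in \<open>Y\<close>.\<close>
  have end_degree: "3 \<le> card {y. adj p y}"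
    if sep: "separation X Y p q" and p2: "2 \<le> card {v \<in> X. adj p v}" for p q
  proof -
    obtain y where y: "y \<in> Y" "adj p y" using separation_attached[OF separation_commute[OF sep]] by blast
    have "y \<notin> X" using y separation_disjoint(6)[OF sep] by blast
    have "finite {v \<in> X. adj p v}" using fin[of p] by (rule rev_finite_subset) auto
    then have "3 \<le> card (insert y {v \<in> X. adj p v})" using p2 \<open>y \<notin> X\<close> by simp
    also have "\<dots> \<le> card {y. adj p y}" using fin y by (intro card_mono) auto
    finally show ?thesis .
  qed
  have "two_sparse (block G X a b)"
    unfolding two_sparse_def
  proof (intro allI impI, rule ccontr)
    fix u' v'
    assume arc: "u' \<rightarrow>\<^bsub>block G X a b\<^esub> v'"
      and "\<not> (out_degree (block G X a b) u' \<le> 2 \<or> out_degree (block G X a b) v' \<le> 2)"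
    then have deg': "3 \<le> out_degree (block G X a b) u'" "3 \<le> out_degree (block G X a b) v'" by auto
    \<comment> \<open>The new vertex has degree at most 2, so both ends of the offending edge are
      old vertices.\<close>
    have "{y. (None, y) \<in> parcs (block G X a b)} = {Some a, Some b}" by (auto simp: block_def)
    then have "out_degree (block G X a b) None \<le> 2"
      by (simp add: out_degree_with_proj card_insert_if)
    with deg' obtain u v where uv': "u' = Some u" "v' = Some v"
      by (cases u'; cases v') auto
    have arcs_block: "(Some x, Some y) \<in> parcs (block G X a b) \<longleftrightarrow>
        adj x y \<and> x \<in> X \<union> {a, b} \<and> y \<in> X \<union> {a, b}" for x y
      by (auto simp: block_def adj_def induce_subgraph_with_proj induced_def)
    have uv: "adj u v" "u \<in> X \<union> {a, b}" "v \<in> X \<union> {a, b}"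
      using arc uv' arcs_block by auto
    \<comment> \<open>Degree at least 3 in the block carries over to \<open>G\<close>: for
      \<open>a\<close> and \<open>b\<close> by \<open>end_degree\<close>, and for a vertex of
      \<open>X\<close> because it is not joined to the new vertex.\<close>
    have deg: "3 \<le> card {y. adj x y}"
      if x: "x \<in> X \<union> {a, b}" and d: "3 \<le> out_degree (block G X a b) (Some x)" for x
    proof (cases "x \<in> X")
      case False
      then show ?thesis using x end_degree[OF sep a2] end_degree[OF separation_swap[OF sep] b2] by auto
    next
      case True
      have "{y. (Some x, y) \<in> parcs (block G X a b)} \<subseteq> Some ` {y. adj x y}"
      proof
        fix y assume y: "y \<in> {y. (Some x, y) \<in> parcs (block G X a b)}"
        have "y \<noteq> None" using y True separation_disjoint[OF sep] by (auto simp: block_def)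
        then show "y \<in> Some ` {y. adj x y}" using y arcs_block by (cases y) auto
      qed
      then have "card {y. (Some x, y) \<in> parcs (block G X a b)} \<le> card (Some ` {y. adj x y})"
        using fin by (intro card_mono) auto
      then show ?thesis using d by (simp add: out_degree_with_proj card_image)
    qed
    show False
      using minimal_edge_sparse[OF s _ uv deg[OF uv(2)] deg[OF uv(3)]] min deg' uv' by blast
  qed
  then show ?thesis using a2 b2 by (simp add: adj_def)
qed

end
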